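(* Let $(H;(\cdot,\cdot))$ be an inner product space over $\mathbb{K}$, let $x,y_1,\dots,y_n\in H$ and $c_1,\dots,c_n\in\mathbb{K}$. Let $p>1$ and $\frac1p+\frac1q=1$. Put $$S_i:=\sum_{j=1}^n|(y_i,y_j)|\quad(1\le i\le n),\qquad S:=\sum_{i,j=1}^n|(y_i,y_j)|.$$ Then $$\left|\sum_{i=1}^n c_i(x,y_i)\right|^2\le \|x\|^2\left(\sum_{i=1}^n|c_i|^pS_i\right)^{\frac1p}\left(\sum_{i=1}^n|c_i|^qS_i\right)^{\frac1q},$$ and the right-hand side of this inequality is less than or equal to $\|x\|^2 B$, where $B$ is any one of the following nine quantities, and where $\alpha,\beta$ are any reals with $\alpha>1$, $\frac1\alpha+\frac1\beta=1$, and $\gamma,\delta$ are any reals with $\gamma>1$, $\frac1\gamma+\frac1\delta=1$ (whenever they occur): (1) $\max_{1\le i\le n}|c_i|^2\, S$; (2) $\max_{1\le i\le n}|c_i|\left(\sum_{i=1}^n|c_i|^{\gamma q}\right)^{\frac1{\gamma q}}S^{\frac1p}\left(\sum_{i=1}^nS_i^{\delta}\right)^{\frac1{\delta q}}$; (3) $\max_{1\le i\le n}|c_i|\left(\sum_{i=1}^n|c_i|^{q}\right)^{\frac1q}S^{\frac1p}\max_{1\le i\le n}S_i^{\frac1q}$; (4) $\max_{1\le i\le n}|c_i|\left(\sum_{i=1}^n|c_i|^{\alpha p}\right)^{\frac1{\alpha p}}S^{\frac1q}\left(\sum_{i=1}^nS_i^{\beta}\right)^{\frac1{p\beta}}$;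 (5) $\left(\sum_{i=1}^n|c_i|^{\alpha p}\right)^{\frac1{\alpha p}}\left(\sum_{i=1}^n|c_i|^{\gamma q}\right)^{\frac1{\gamma q}}\left(\sum_{i=1}^nS_i^{\beta}\right)^{\frac1{p\beta}}\left(\sum_{i=1}^nS_i^{\delta}\right)^{\frac1{\delta q}}$; (6) $\left(\sum_{i=1}^n|c_i|^{q}\right)^{\frac1q}\left(\sum_{i=1}^n|c_i|^{\alpha p}\right)^{\frac1{\alpha p}}\max_{1\le i\le n}S_i^{\frac1q}\left(\sum_{i=1}^nS_i^{\beta}\right)^{\frac1{p\beta}}$; (7) $\max_{1\le i\le n}|c_i|\left(\sum_{i=1}^n|c_i|^{p}\right)^{\frac1p}\max_{1\le i\le n}S_i^{\frac1p}\;S^{\frac1q}$; (8) $\left(\sum_{i=1}^n|c_i|^{p}\right)^{\frac1p}\left(\sum_{i=1}^n|c_i|^{\gamma q}\right)^{\frac1{\gamma q}}\max_{1\le i\le n}S_i^{\frac1p}\left(\sum_{i=1}^nS_i^{\delta}\right)^{\frac1{\delta q}}$; (9) $\left(\sum_{i=1}^n|c_i|^{p}\right)^{\frac1p}\left(\sum_{i=1}^n|c_i|^{q}\right)^{\frac1q}\max_{1\le i\le n}S_i$.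
   Context: $\mathbb{K}$ denotes the scalar field of $H$, either $\mathbb{R}$ or $\mathbb{C}$; the inner product is linear in the first argument and conjugate-linear in the second; $\|x\|=\sqrt{(x,x)}$; $n\ge1$ is an integer. *)

theory Defs
  imports "HOL-Analysis.Analysis"
begin

text \<open>
  The scalar field is either the real or the complex field. The class of such fields is given by
  an isometric embedding into the complex numbers whose range is one of the two; the embedding is
  only used to speak of conjugates and real parts of scalars uniformly in both cases.
\<close>

class real_or_complex = real_normed_field +
  fixes to_complex :: "'a \<Rightarrow> complex"
  assumes to_complex_add: "to_complex (a + b) = to_complex a + to_complex b"
    and to_complex_mult: "to_complex (a * b) = to_complex a * to_complex b"
    and to_complex_scaleR: "to_complex (r *\<^sub>R a) = r *\<^sub>R to_complex a"
    and norm_to_complex: "norm (to_complex a) = norm a"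
    and range_to_complex: "range to_complex = \<real> \<or> range to_complex = UNIV"

instantiation real :: real_or_complex
begin

definition to_complex_real :: "real \<Rightarrow> complex" where
  "to_complex_real a = complex_of_real a"

instance
  by standard (auto simp: to_complex_real_def Reals_def scaleR_conv_of_real)

end

instantiation complex :: real_or_complex
begin

definition to_complex_complex :: "complex \<Rightarrow> complex" where
  "to_complex_complex a = a"

instance
  by standard (auto simp: to_complex_complex_def)

end

locale inner_product_space = vector_space scale
  for scale :: "'k::real_or_complex \<Rightarrow> 'v::ab_group_add \<Rightarrow> 'v" +
  fixes ip :: "'v \<Rightarrow> 'v \<Rightarrow> 'k"
  assumes ip_add_left: "ip (x + y) z = ip x z + ip y z"
    and ip_scale_left: "ip (scale a x) z = a * ip x z"
    and ip_hermitian: "to_complex (ip y x) = cnj (to_complex (ip x y))"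
    and ip_nonneg: "0 \<le> Re (to_complex (ip x x))"
    and ip_eq_zero_iff: "ip x x = 0 \<longleftrightarrow> x = 0"

text \<open>The scalar \<open>ip x x\<close> is real by Hermitian symmetry, so taking the real part loses nothing.\<close>

definition ip_norm :: "('v \<Rightarrow> 'v \<Rightarrow> 'k::real_or_complex) \<Rightarrow> 'v \<Rightarrow> real" where
  "ip_norm ip x = sqrt (Re (to_complex (ip x x)))"

lemma inner_product_space_real_inner:
  "inner_product_space scaleR (inner :: 'a::real_inner \<Rightarrow> 'a \<Rightarrow> real)"
  by unfold_locales
    (auto simp: inner_add_left inner_commute to_complex_real_def algebra_simps)

lemma inner_product_space_complex:
  "inner_product_space (*) (\<lambda>x y :: complex. x * cnj y)"
  by unfold_locales (auto simp: to_complex_complex_def algebra_simps)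

lemma ip_norm_real_inner: "ip_norm (inner :: 'a::real_inner \<Rightarrow> 'a \<Rightarrow> real) x = norm x"
  by (simp add: ip_norm_def to_complex_real_def norm_eq_sqrt_inner)

end

theory Submission imports Defs begin

text \<open>
  With \<open>z = (\<Sum>i. cnj (c i) y\<^sub>i)\<close> the left-hand side is \<open>\<bar>(x, z)\<bar>\<^sup>2\<close>, so Cauchy--Schwarz bounds it by
  \<open>\<parallel>x\<parallel>\<^sup>2 \<Sum>i j. \<bar>c i\<bar> \<bar>c j\<bar> \<bar>(y\<^sub>i, y\<^sub>j)\<bar>\<close>. Hoelder's inequality over pairs with the symmetric weights
  \<open>\<bar>(y\<^sub>i, y\<^sub>j)\<bar>\<close> gives the first inequality. Each factor \<open>(\<Sum>i. \<bar>c i\<bar>\<^sup>r S\<^sub>i)\<^bsup>1/r\<^esup>\<close> is then bounded in one of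
  three ways, by Hoelder with exponents \<open>(\<infinity>, 1)\<close>, \<open>(\<alpha>, \<beta>)\<close> or \<open>(1, \<infinity>)\<close>; the nine combinations for
  \<open>r = p\<close> and \<open>r = q\<close> are the nine bounds.
\<close>

subsection \<open>Finite sums\<close>

lemma conjugate_exponent_gt_1:
  fixes p q :: real
  assumes "p > 1" "1 / p + 1 / q = 1"
  shows "q > 1"
proof -
  have "1 / p < 1" "1 / p > 0" using assms(1) by auto
  \<comment> \<open>Strict positivity of \<open>1 / q\<close> also excludes \<open>q = 0\<close>,
    where \<open>1 / q\<close> is \<open>0\<close>.\<close>
  then have "0 < 1 / q" "1 / q < 1" using assms(2) by linarith+
  then show ?thesis by (simp add: divide_less_eq)
qed

text \<open>Scaling both families to unit norm reduces the claim to Young's inequality term by term;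
  the terms then add up to \<open>1 / p + 1 / q = 1\<close>.\<close>

lemma Holder_inequality_sum:
  fixes f g :: "'a \<Rightarrow> real"
  assumes p: "p > 1" and pq: "1 / p + 1 / q = 1"
    and A: "finite A"
    and f: "\<And>i. i \<in> A \<Longrightarrow> 0 \<le> f i" and g: "\<And>i. i \<in> A \<Longrightarrow> 0 \<le> g i"
  shows "(\<Sum>i\<in>A. f i * g i) \<le> (\<Sum>i\<in>A. f i powr p) powr (1 / p) * (\<Sum>i\<in>A. g i powr q) powr (1 / q)"
proof -
  define F where "F = (\<Sum>i\<in>A. f i powr p)"
  define G where "G = (\<Sum>i\<in>A. g i powr q)"
  have q: "q > 1" using conjugate_exponent_gt_1[OF p pq] .
  have nn: "F \<ge> 0" "G \<ge> 0" unfolding F_def G_def by (auto intro: sum_nonneg)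
  show ?thesis
  \<comment> \<open>The scaling divides by powers of \<open>F\<close> and \<open>G\<close>. If one
    of them vanishes, so does a whole family, and the left-hand side is \<open>0\<close>.\<close>
  proof (cases "F = 0 \<or> G = 0")
    case True
    then have "\<forall>i\<in>A. f i * g i = 0"
      unfolding F_def G_def using A by (auto simp: sum_nonneg_eq_0_iff)
    then have "(\<Sum>i\<in>A. f i * g i) = 0" by (rule sum.neutral)
    then show ?thesis by simp
  next
    case False
    then have pos: "F > 0" "G > 0" using nn by auto
    define a where "a i = f i / F powr (1 / p)" for i
    define b where "b i = g i / G powr (1 / q)" for i
    have "(\<Sum>i\<in>A. a i * b i) \<le> (\<Sum>i\<in>A. a i powr p / p + b i powr q / q)"
      by (intro sum_mono Youngs_inequality) (use p q pq f g in \<open>auto simp: a_def b_def\<close>)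
    also have "\<dots> = (\<Sum>i\<in>A. f i powr p / F / p + g i powr q / G / q)"
      using p q pos by (intro sum.cong refl) (simp add: a_def b_def powr_divide powr_powr)
    also have "\<dots> = F / F / p + G / G / q"
      by (simp add: sum.distrib F_def G_def flip: sum_divide_distrib)
    also have "\<dots> = 1" using pos pq by simp
    finally have "(\<Sum>i\<in>A. f i * g i) / (F powr (1 / p) * G powr (1 / q)) \<le> 1"
      by (simp add: a_def b_def sum_divide_distrib)
    then show ?thesis using pos by (simp add: F_def G_def divide_le_eq)
  qed
qed

text \<open>The weight splits as \<open>w i powr (1 / p) * w i powr (1 / q)\<close>; absorbing one
  part into \<open>f\<close> and the other into \<open>g\<close> reduces this to the unweighted
  inequality.\<close>

lemma Holder_inequality_weighted_sum:
  fixes f g w :: "'a \<Rightarrow> real"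
  assumes p: "p > 1" and pq: "1 / p + 1 / q = 1"
    and A: "finite A"
    and f: "\<And>i. i \<in> A \<Longrightarrow> 0 \<le> f i" and g: "\<And>i. i \<in> A \<Longrightarrow> 0 \<le> g i"
    and w: "\<And>i. i \<in> A \<Longrightarrow> 0 \<le> w i"
  shows "(\<Sum>i\<in>A. f i * g i * w i)
    \<le> (\<Sum>i\<in>A. f i powr p * w i) powr (1 / p) * (\<Sum>i\<in>A. g i powr q * w i) powr (1 / q)"
proof -
  have q: "q > 1" using conjugate_exponent_gt_1[OF p pq] .
  have "(\<Sum>i\<in>A. f i * g i * w i)
      = (\<Sum>i\<in>A. (f i * w i powr (1 / p)) * (g i * w i powr (1 / q)))"
  proof (intro sum.cong refl)
    fix i assume "i \<in> A"
    then have "w i = w i powr (1 / p) * w i powr (1 / q)"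
      using w pq by (simp flip: powr_add)
    then show "f i * g i * w i = (f i * w i powr (1 / p)) * (g i * w i powr (1 / q))"
      by (simp add: mult_ac)
  qed
  also have "\<dots> \<le> (\<Sum>i\<in>A. (f i * w i powr (1 / p)) powr p) powr (1 / p)
      * (\<Sum>i\<in>A. (g i * w i powr (1 / q)) powr q) powr (1 / q)"
    by (rule Holder_inequality_sum) (use assms in auto)
  also have "\<dots> = (\<Sum>i\<in>A. f i powr p * w i) powr (1 / p) * (\<Sum>i\<in>A. g i powr q * w i) powr (1 / q)"
    using p q w by (simp add: powr_mult powr_powr)
  finally show ?thesis .
qed

section \<open>Three estimates for one weighted power sum\<close>

lemma Max_powr:
  fixes f :: "'a \<Rightarrow> real"
  assumes "finite A" "A \<noteq> {}" "r \<ge> 0" "\<And>i. i \<in> A \<Longrightarrow> 0 \<le> f i"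
  shows "(MAX i\<in>A. f i powr r) = (MAX i\<in>A. f i) powr r"
proof (rule Max_eqI)
  have "Max (f ` A) \<in> f ` A" using assms by simp
  then show "Max (f ` A) powr r \<in> (\<lambda>i. f i powr r) ` A" by auto
qed (use assms in \<open>auto intro!: powr_mono2\<close>)

text \<open>This is the exponent pair (\<infinity>, 1): every \<open>a i\<close> is replaced by the
  maximum, whose power \<open>r\<close> cancels against the outer \<open>1 / r\<close>.\<close>

lemma weighted_powr_sum_le_Max:
  fixes a w :: "'a \<Rightarrow> real"
  assumes "finite A" "r > 1"
    and a: "\<And>i. i \<in> A \<Longrightarrow> 0 \<le> a i" and w: "\<And>i. i \<in> A \<Longrightarrow> 0 \<le> w i"
  shows "(\<Sum>i\<in>A. a i powr r * w i) powr (1 / r) \<le> (MAX i\<in>A. a i) * (\<Sum>i\<in>A. w i) powr (1 / r)"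
\<comment> \<open>On the empty set the maximum is unspecified, but both sides vanish because
  \<open>0 powr (1 / r) = 0\<close>.\<close>
proof (cases "A = {}")
  case False
  let ?M = "MAX i\<in>A. a i"
  have M: "a i \<le> ?M" if "i \<in> A" for i using assms that by simp
  then have "?M \<ge> 0" using False a by (meson all_not_in_conv order_trans)
  have "(\<Sum>i\<in>A. a i powr r * w i) \<le> (\<Sum>i\<in>A. ?M powr r * w i)"
    using assms M by (intro sum_mono mult_right_mono powr_mono2) auto
  then have "(\<Sum>i\<in>A. a i powr r * w i) powr (1 / r) \<le> (?M powr r * (\<Sum>i\<in>A. w i)) powr (1 / r)"
    using assms by (intro powr_mono2) (auto intro!: sum_nonneg simp: sum_distrib_left)
  then show ?thesis using \<open>?M \<ge> 0\<close> assms(2) by (simp add: powr_mult powr_powr)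
qed simp

text \<open>Hoelder's inequality is applied to \<open>a i powr r\<close> and \<open>w i\<close>;
  taking the power \<open>1 / r\<close> afterwards multiplies the exponents.\<close>

lemma weighted_powr_sum_le_Holder:
  fixes a w :: "'a \<Rightarrow> real"
  assumes "finite A" "r > 1" "\<alpha> > 1" "1 / \<alpha> + 1 / \<beta> = 1"
    and a: "\<And>i. i \<in> A \<Longrightarrow> 0 \<le> a i" and w: "\<And>i. i \<in> A \<Longrightarrow> 0 \<le> w i"
  shows "(\<Sum>i\<in>A. a i powr r * w i) powr (1 / r)
    \<le> (\<Sum>i\<in>A. a i powr (\<alpha> * r)) powr (1 / (\<alpha> * r)) * (\<Sum>i\<in>A. w i powr \<beta>) powr (1 / (r * \<beta>))"
proof -
  have "(\<Sum>i\<in>A. a i powr r * w i)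
      \<le> (\<Sum>i\<in>A. (a i powr r) powr \<alpha>) powr (1 / \<alpha>) * (\<Sum>i\<in>A. w i powr \<beta>) powr (1 / \<beta>)"
    by (rule Holder_inequality_sum) (use assms in auto)
  then have "(\<Sum>i\<in>A. a i powr r * w i) powr (1 / r)
      \<le> ((\<Sum>i\<in>A. (a i powr r) powr \<alpha>) powr (1 / \<alpha>) * (\<Sum>i\<in>A. w i powr \<beta>) powr (1 / \<beta>)) powr (1 / r)"
    using assms by (intro powr_mono2) (auto intro!: sum_nonneg)
  then show ?thesis by (simp add: powr_mult powr_powr mult.commute)
qed

text \<open>This is the opposite extreme (1, \<infinity>): every weight is replaced by the largest
  one. The power is then moved inside the maximum by \<open>Max_powr\<close>, which is the form
  taken by the final bounds.\<close>

lemma weighted_powr_sum_le_Max_weight: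
  fixes a w :: "'a \<Rightarrow> real"
  assumes "finite A" "A \<noteq> {}" "r > 1"
    and a: "\<And>i. i \<in> A \<Longrightarrow> 0 \<le> a i" and w: "\<And>i. i \<in> A \<Longrightarrow> 0 \<le> w i"
  shows "(\<Sum>i\<in>A. a i powr r * w i) powr (1 / r)
    \<le> (\<Sum>i\<in>A. a i powr r) powr (1 / r) * (MAX i\<in>A. w i powr (1 / r))"
proof -
  have "(\<Sum>i\<in>A. a i powr r * w i) \<le> (\<Sum>i\<in>A. a i powr r * (MAX i\<in>A. w i))"
    using assms by (intro sum_mono mult_left_mono) auto
  then have "(\<Sum>i\<in>A. a i powr r * w i) powr (1 / r)
      \<le> ((\<Sum>i\<in>A. a i powr r) * (MAX i\<in>A. w i)) powr (1 / r)"
    using assms by (intro powr_mono2) (auto intro!: sum_nonneg simp: sum_distrib_right)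
  then show ?thesis using assms by (simp add: powr_mult Max_powr)
qed

subsection \<open>Inner product spaces over the real or complex field\<close>

lemma to_complex_0 [simp]: "to_complex 0 = 0"
  using to_complex_add[of 0 0] by simp

lemma to_complex_diff: "to_complex (a - b) = to_complex a - to_complex b"
  using to_complex_add[of "a - b" b] by simp

lemma to_complex_sum: "to_complex (\<Sum>i\<in>A. f i) = (\<Sum>i\<in>A. to_complex (f i))"
  by (induction A rule: infinite_finite_induct) (auto simp: to_complex_add)

lemma to_complex_eq_0_iff [simp]: "to_complex a = 0 \<longleftrightarrow> a = 0"
  using norm_to_complex[of a] by auto

text \<open>Conjugation is available only through the embedding; it can be pulled back because both
  possible ranges, the reals and all of the complex numbers, are closed under it.\<close>

lemma ex_conjugate: "\<exists>b :: 'k. to_complex b = cnj (to_complex (a :: 'k::real_or_complex))"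
proof -
  have "cnj (to_complex a) \<in> range (to_complex :: 'k \<Rightarrow> complex)"
    using range_to_complex[where 'a = 'k]
  proof
    assume r: "range (to_complex :: 'k \<Rightarrow> complex) = \<real>"
    then have "to_complex a \<in> \<real>" by blast
    then show ?thesis using r by (auto simp: Reals_cnj_iff)
  qed simp
  then obtain b where "cnj (to_complex a) = to_complex (b :: 'k)" by (rule rangeE)
  then show ?thesis by metis
qed

section \<open>Cauchy-Schwarz and the estimate by weighted power sums\<close>

context inner_product_space
begin

lemma ip_0_left [simp]: "ip 0 z = 0"
  using ip_add_left[of 0 0 z] by simp

lemma ip_0_right [simp]: "ip z 0 = 0"
  using ip_hermitian[of z 0] by simp

lemma ip_sum_left: "ip (\<Sum>i\<in>A. f i) z = (\<Sum>i\<in>A. ip (f i) z)"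
  by (induction A rule: infinite_finite_induct) (auto simp: ip_add_left)

lemma norm_ip_commute: "norm (ip y x) = norm (ip x y)"
  by (metis ip_hermitian norm_to_complex complex_mod_cnj)

lemma to_complex_ip_self: "to_complex (ip x x) = of_real (Re (to_complex (ip x x)))"
  using ip_hermitian[of x x] by (simp add: complex_eq_iff)

text \<open>Subtracting from \<open>x\<close> its projection onto \<open>z\<close> leaves a vector
  whose squared norm is \<open>(x,x) - |(x,z)|^2 / (z,z)\<close>, and this is nonnegative.\<close>

lemma Cauchy_Schwarz_ip:
  "(norm (ip x z))\<^sup>2 \<le> Re (to_complex (ip x x)) * Re (to_complex (ip z z))"
proof (cases "z = 0")
  case False
  define r where "r = Re (to_complex (ip z z))"
  have zz: "to_complex (ip z z) = of_real r" using to_complex_ip_self r_def by simp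
  have "ip z z \<noteq> 0" using False ip_eq_zero_iff by blast
  then have r: "r > 0"
    using zz ip_nonneg[of z] r_def by (metis less_eq_real_def of_real_0 to_complex_eq_0_iff)
  \<comment> \<open>The coefficient of the projection, chosen to make the remainder \<open>u\<close>
    orthogonal to \<open>z\<close>.\<close>
  define a where "a = ip x z / ip z z"
  have "a * ip z z = ip x z" using \<open>ip z z \<noteq> 0\<close> by (simp add: a_def)
  then have a: "to_complex a = to_complex (ip x z) / of_real r"
    using r zz by (metis to_complex_mult nonzero_eq_divide_eq of_real_eq_0_iff less_irrefl)
  define u where "u = x + scale (- a) z"
  have left: "ip u v = ip x v - a * ip z v" for v
    by (simp add: u_def ip_add_left ip_scale_left del: scale_minus_left)
  have "ip u z = 0" using left \<open>a * ip z z = ip x z\<close> by simp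
  then have "ip z u = 0" using ip_hermitian[of z u] by simp
  \<comment> \<open>Orthogonality removes the term in \<open>z\<close>. Hermitian symmetry then
    moves \<open>u\<close> to the left argument, where \<open>left\<close> can expand it; the
    conjugate does not affect the real part.\<close>
  then have "ip u u = ip x u" by (simp add: left)
  then have "to_complex (ip u u) = cnj (to_complex (ip u x))" by (metis ip_hermitian)
  then have "Re (to_complex (ip u u)) = Re (to_complex (ip x x - a * ip z x))"
    by (simp add: left)
  also have "\<dots> = Re (to_complex (ip x x)) - Re (to_complex a * to_complex (ip z x))"
    by (simp add: to_complex_diff to_complex_mult)
  also have "to_complex a * to_complex (ip z x) = of_real ((norm (ip x z))\<^sup>2 / r)"
    using ip_hermitian[of z x]
    by (simp add: a complex_norm_square[symmetric] norm_to_complex flip: of_real_power)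
  finally have "(norm (ip x z))\<^sup>2 / r \<le> Re (to_complex (ip x x))"
    using ip_nonneg[of u] by simp
  then show ?thesis using r by (simp add: divide_le_eq flip: r_def)
qed simp

text \<open>Cauchy-Schwarz leaves the squared norm of the combined vector \<open>z\<close>, which
  the triangle inequality expands in one argument at a time.\<close>

lemma norm_sum_ip_squared_le:
  fixes c :: "'i \<Rightarrow> 'k"
  shows "(norm (\<Sum>i\<in>A. c i * ip x (y i)))\<^sup>2
    \<le> (ip_norm ip x)\<^sup>2 * (\<Sum>i\<in>A. \<Sum>j\<in>A. norm (c i) * norm (c j) * norm (ip (y i) (y j)))"
proof -
  \<comment> \<open>The second argument is conjugate-linear, so \<open>z\<close> needs conjugated
    coefficients for the \<open>c i\<close> themselves to come out.\<close>
  obtain d :: "'i \<Rightarrow> 'k" where d: "to_complex (d i) = cnj (to_complex (c i))" for i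
    using choice[of "\<lambda>i b. to_complex b = cnj (to_complex (c i))"] ex_conjugate by blast
  have norm_d: "norm (d i) = norm (c i)" for i
    by (metis d norm_to_complex complex_mod_cnj)
  define z where "z = (\<Sum>i\<in>A. scale (d i) (y i))"
  have z_left: "ip z v = (\<Sum>i\<in>A. d i * ip (y i) v)" for v
    by (simp add: z_def ip_sum_left ip_scale_left)
  \<comment> \<open>The vector \<open>v\<close> stays general for two uses: \<open>x\<close> gives
    the left-hand side of the claim, and each \<open>y i\<close> serves in expanding
    \<open>ip z z\<close>.\<close>
  have norm_z: "norm (ip v z) = norm (\<Sum>i\<in>A. c i * ip v (y i))" for v
  proof -
    have "to_complex (ip v z) = cnj (\<Sum>i\<in>A. to_complex (d i) * to_complex (ip (y i) v))"
      by (simp add: ip_hermitian[of v z] z_left to_complex_sum to_complex_mult)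
    also have "\<dots> = (\<Sum>i\<in>A. to_complex (c i) * to_complex (ip v (y i)))"
      unfolding cnj_sum
      by (intro sum.cong refl) (metis complex_cnj_mult complex_cnj_cnj d ip_hermitian)
    also have "\<dots> = to_complex (\<Sum>i\<in>A. c i * ip v (y i))"
      by (simp add: to_complex_sum to_complex_mult)
    finally show ?thesis by (metis norm_to_complex)
  qed
  have "Re (to_complex (ip z z)) \<le> norm (ip z z)"
    by (metis complex_Re_le_cmod norm_to_complex)
  also have "\<dots> \<le> (\<Sum>i\<in>A. norm (c i) * norm (ip (y i) z))"
    unfolding z_left by (rule norm_sum[THEN order_trans]) (simp add: norm_mult norm_d)
  also have "\<dots> \<le> (\<Sum>i\<in>A. norm (c i) * (\<Sum>j\<in>A. norm (c j) * norm (ip (y i) (y j))))"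
    unfolding norm_z
    by (intro sum_mono mult_left_mono norm_sum[THEN order_trans]) (auto simp: norm_mult)
  finally have "Re (to_complex (ip z z))
      \<le> (\<Sum>i\<in>A. \<Sum>j\<in>A. norm (c i) * norm (c j) * norm (ip (y i) (y j)))"
    by (simp add: sum_distrib_left mult.assoc)
  then have "Re (to_complex (ip x x)) * Re (to_complex (ip z z)) \<le> Re (to_complex (ip x x)) *
      (\<Sum>i\<in>A. \<Sum>j\<in>A. norm (c i) * norm (c j) * norm (ip (y i) (y j)))"
    by (intro mult_left_mono ip_nonneg)
  with Cauchy_Schwarz_ip[of x z] show ?thesis
    by (simp add: norm_z ip_norm_def ip_nonneg)
qed

text \<open>In the double sum one coefficient depends only on the first index and the other only on
  the second. After Hoelder over pairs, each factor can therefore be summed over its idle index,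
  which leaves row sums of the weights.\<close>

lemma norm_sum_ip_squared_le_Holder:
  assumes p: "p > 1" "1 / p + 1 / q = 1" and A: "finite A"
  shows "(norm (\<Sum>i\<in>A. c i * ip x (y i)))\<^sup>2
    \<le> (ip_norm ip x)\<^sup>2
      * (\<Sum>i\<in>A. norm (c i) powr p * (\<Sum>j\<in>A. norm (ip (y i) (y j)))) powr (1 / p)
      * (\<Sum>i\<in>A. norm (c i) powr q * (\<Sum>j\<in>A. norm (ip (y i) (y j)))) powr (1 / q)"
proof -
  define w where "w i j = norm (ip (y i) (y j))" for i j
  have "(\<Sum>i\<in>A. \<Sum>j\<in>A. norm (c i) * norm (c j) * w i j)
      = (\<Sum>k\<in>A \<times> A. norm (c (fst k)) * norm (c (snd k)) * w (fst k) (snd k))"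
    unfolding sum.cartesian_product case_prod_unfold ..
  also have "\<dots> \<le> (\<Sum>k\<in>A \<times> A. norm (c (fst k)) powr p * w (fst k) (snd k)) powr (1 / p)
      * (\<Sum>k\<in>A \<times> A. norm (c (snd k)) powr q * w (fst k) (snd k)) powr (1 / q)"
    by (rule Holder_inequality_weighted_sum[OF p]) (auto simp: A w_def)
  also have "(\<Sum>k\<in>A \<times> A. norm (c (fst k)) powr p * w (fst k) (snd k))
      = (\<Sum>i\<in>A. norm (c i) powr p * (\<Sum>j\<in>A. w i j))"
    unfolding sum_distrib_left sum.cartesian_product case_prod_unfold ..
  also have "(\<Sum>k\<in>A \<times> A. norm (c (snd k)) powr q * w (fst k) (snd k))
      = (\<Sum>i\<in>A. \<Sum>j\<in>A. norm (c j) powr q * w i j)"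
    unfolding sum.cartesian_product case_prod_unfold ..
  \<comment> \<open>Here the idle index is the first, giving column sums; symmetry of the weights
    turns them into row sums.\<close>
  also have "\<dots> = (\<Sum>j\<in>A. norm (c j) powr q * (\<Sum>i\<in>A. w j i))"
    by (subst sum.swap) (simp add: sum_distrib_left w_def norm_ip_commute)
  finally have "(ip_norm ip x)\<^sup>2 * (\<Sum>i\<in>A. \<Sum>j\<in>A. norm (c i) * norm (c j) * w i j)
     \<le> (ip_norm ip x)\<^sup>2 * ((\<Sum>i\<in>A. norm (c i) powr p * (\<Sum>j\<in>A. w i j)) powr (1 / p)
      * (\<Sum>j\<in>A. norm (c j) powr q * (\<Sum>i\<in>A. w j i)) powr (1 / q))"
    by (intro mult_left_mono) auto
  with norm_sum_ip_squared_le[of c x y A] show ?thesis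
    by (simp add: w_def mult.assoc)
qed

end

section \<open>The Hoelder-type inequality and its nine upper bounds\<close>

theorem theorem2:
  fixes scale :: "'k::real_or_complex \<Rightarrow> 'v::ab_group_add \<Rightarrow> 'v"
    and ip :: "'v \<Rightarrow> 'v \<Rightarrow> 'k"
    and x :: 'v and y :: "nat \<Rightarrow> 'v" and c :: "nat \<Rightarrow> 'k"
    and n :: nat and p q :: real
    and Si :: "nat \<Rightarrow> real" and S :: real
  assumes "inner_product_space scale ip"
    and "n \<ge> 1"
    and "p > 1" and "1 / p + 1 / q = 1"
    and "\<And>i. i \<in> {1..n} \<Longrightarrow> Si i = (\<Sum>j=1..n. norm (ip (y i) (y j)))"
    and "S = (\<Sum>i=1..n. \<Sum>j=1..n. norm (ip (y i) (y j)))"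
  shows
    "let M = (MAX i\<in>{1..n}. norm (c i));
         C = (\<lambda>r. (\<Sum>i=1..n. norm (c i) powr r) powr (1 / r));
         R = (ip_norm ip x)\<^sup>2
               * (\<Sum>i=1..n. norm (c i) powr p * Si i) powr (1 / p)
               * (\<Sum>i=1..n. norm (c i) powr q * Si i) powr (1 / q)
     in (norm (\<Sum>i=1..n. c i * ip x (y i)))\<^sup>2 \<le> R
      \<and> R \<le> (ip_norm ip x)\<^sup>2 * ((MAX i\<in>{1..n}. (norm (c i))\<^sup>2) * S)
      \<and> (\<forall>\<gamma> \<delta>. \<gamma> > 1 \<and> 1 / \<gamma> + 1 / \<delta> = 1 \<longrightarrow>
           R \<le> (ip_norm ip x)\<^sup>2 *
             (M * C (\<gamma> * q) * S powr (1 / p) * (\<Sum>i=1..n. Si i powr \<delta>) powr (1 / (\<delta> * q))))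
      \<and> R \<le> (ip_norm ip x)\<^sup>2 *
             (M * C q * S powr (1 / p) * (MAX i\<in>{1..n}. Si i powr (1 / q)))
      \<and> (\<forall>\<alpha> \<beta>. \<alpha> > 1 \<and> 1 / \<alpha> + 1 / \<beta> = 1 \<longrightarrow>
           R \<le> (ip_norm ip x)\<^sup>2 *
             (M * C (\<alpha> * p) * S powr (1 / q) * (\<Sum>i=1..n. Si i powr \<beta>) powr (1 / (p * \<beta>))))
      \<and> (\<forall>\<alpha> \<beta> \<gamma> \<delta>. \<alpha> > 1 \<and> 1 / \<alpha> + 1 / \<beta> = 1 \<and> \<gamma> > 1 \<and> 1 / \<gamma> + 1 / \<delta> = 1 \<longrightarrow>
           R \<le> (ip_norm ip x)\<^sup>2 *
             (C (\<alpha> * p) * C (\<gamma> * q)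
               * (\<Sum>i=1..n. Si i powr \<beta>) powr (1 / (p * \<beta>))
               * (\<Sum>i=1..n. Si i powr \<delta>) powr (1 / (\<delta> * q))))
      \<and> (\<forall>\<alpha> \<beta>. \<alpha> > 1 \<and> 1 / \<alpha> + 1 / \<beta> = 1 \<longrightarrow>
           R \<le> (ip_norm ip x)\<^sup>2 *
             (C q * C (\<alpha> * p) * (MAX i\<in>{1..n}. Si i powr (1 / q))
               * (\<Sum>i=1..n. Si i powr \<beta>) powr (1 / (p * \<beta>))))
      \<and> R \<le> (ip_norm ip x)\<^sup>2 *
             (M * C p * (MAX i\<in>{1..n}. Si i powr (1 / p)) * S powr (1 / q))
      \<and> (\<forall>\<gamma> \<delta>. \<gamma> > 1 \<and> 1 / \<gamma> + 1 / \<delta> = 1 \<longrightarrow>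
           R \<le> (ip_norm ip x)\<^sup>2 *
             (C p * C (\<gamma> * q) * (MAX i\<in>{1..n}. Si i powr (1 / p))
               * (\<Sum>i=1..n. Si i powr \<delta>) powr (1 / (\<delta> * q))))
      \<and> R \<le> (ip_norm ip x)\<^sup>2 * (C p * C q * (MAX i\<in>{1..n}. Si i))"
proof -
  interpret inner_product_space scale ip by fact
  let ?A = "{1..n}"
  \<comment> \<open>\<open>P p\<close> and \<open>P q\<close> are the two factors to be estimated;
    \<open>C\<close>, \<open>M\<close>, \<open>X\<close> and \<open>D\<close> are the building
    blocks of the bounds.\<close>
  define P where "P = (\<lambda>r. (\<Sum>i=1..n. norm (c i) powr r * Si i) powr (1 / r))"
  define C where "C = (\<lambda>r. (\<Sum>i=1..n. norm (c i) powr r) powr (1 / r))"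
  define M where "M = (MAX i\<in>?A. norm (c i))"
  define X where "X = (\<lambda>r. MAX i\<in>?A. Si i powr (1 / r))"
  define D where "D = (\<lambda>r \<beta>. (\<Sum>i=1..n. Si i powr \<beta>) powr (1 / (r * \<beta>)))"
  define N where "N = (ip_norm ip x)\<^sup>2"
  have q: "q > 1" using conjugate_exponent_gt_1 assms(3,4) by blast
  have A: "finite ?A" "?A \<noteq> {}" using assms(2) by auto
  have Si: "Si i \<ge> 0" if "i \<in> ?A" for i using assms(5)[OF that] by (simp add: sum_nonneg)
  have S: "S = (\<Sum>i=1..n. Si i)" using assms(5,6) by simp
  have "S \<ge> 0" using Si by (auto simp: S intro: sum_nonneg)
  have bound_M: "P r \<le> M * S powr (1 / r)" if "r > 1" for r
    unfolding P_def M_def S by (rule weighted_powr_sum_le_Max) (use that Si in auto)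
  have bound_H: "P r \<le> C (\<alpha> * r) * D r \<beta>"
    if "r > 1" "\<alpha> > 1" "1 / \<alpha> + 1 / \<beta> = 1" for r \<alpha> \<beta>
    unfolding P_def C_def D_def by (rule weighted_powr_sum_le_Holder) (use that Si in auto)
  have bound_X: "P r \<le> C r * X r" if "r > 1" for r
    unfolding P_def C_def X_def
    by (rule weighted_powr_sum_le_Max_weight) (use that Si A in auto)
  have P: "P r \<ge> 0" for r by (simp add: P_def)
  have N: "N \<ge> 0" by (simp add: N_def)
  \<comment> \<open>The separate equation \<open>a * b = B\<close> allows for the order in which
    each bound lists its factors.\<close>
  have combine: "N * P p * P q \<le> N * B" if "P p \<le> a" "P q \<le> b" "a * b = B" for a b B
  proof -
    have "P p * P q \<le> a * b" using that P order_trans by (intro mult_mono) blast+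
    then show ?thesis using N that(3) by (simp add: mult.assoc mult_left_mono)
  qed
  have MM: "(MAX i\<in>?A. (norm (c i))\<^sup>2) = M\<^sup>2"
    using Max_powr[of ?A 2 "\<lambda>i. norm (c i)"] Max_ge_iff[of "(\<lambda>i. norm (c i)) ` ?A" 0] A
    by (auto simp: M_def)
  \<comment> \<open>When both factors are estimated in the same extreme way, the complementary
    exponents recombine to 1; nonnegativity of the base gives \<open>S powr 1 = S\<close>. The same
    happens for the maximum in \<open>XX\<close>.\<close>
  have SS: "S powr (1 / p) * S powr (1 / q) = S"
    using assms(4) \<open>S \<ge> 0\<close> by (simp flip: powr_add)
  have X: "X r = (MAX i\<in>?A. Si i) powr (1 / r)" if "r > 1" for r
    unfolding X_def using that A Si by (intro Max_powr) auto
  have "(MAX i\<in>?A. Si i) \<ge> 0" using A Si by (auto simp: Max_ge_iff)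
  then have XX: "X p * X q = (MAX i\<in>?A. Si i)"
    using X assms(3,4) q by (simp flip: powr_add)
  \<comment> \<open>The statement writes the exponents as \<open>1 / (p * \<beta>)\<close> but
    \<open>1 / (\<delta> * q)\<close>, so \<open>D\<close> is finally unfolded in one way for
    \<open>p\<close> and in the other for \<open>q\<close>.\<close>
  have D: "D r \<beta> = (\<Sum>i=1..n. Si i powr \<beta>) powr (1 / (\<beta> * r))" for r \<beta>
    by (simp add: D_def mult.commute)
  \<comment> \<open>From here on \<open>M\<close>, \<open>H\<close> and \<open>X\<close> name the
    three estimates, each first for \<open>p\<close> and then for \<open>q\<close>.\<close>
  note M = bound_M[OF assms(3)] bound_M[OF q]
  note H = bound_H[OF assms(3)] bound_H[OF q]
  note X = bound_X[OF assms(3)] bound_X[OF q]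
  have "(norm (\<Sum>i=1..n. c i * ip x (y i)))\<^sup>2 \<le> N * P p * P q"
    using norm_sum_ip_squared_le_Holder[OF assms(3,4), of ?A c x y] assms(5)
    by (simp add: N_def P_def)
  \<comment> \<open>The nine pairings follow: the estimate of \<open>P p\<close> runs through
    \<open>M\<close>, \<open>H\<close>, \<open>X\<close>, and for each of these so does that of
    \<open>P q\<close>.\<close>
  moreover have "N * P p * P q \<le> N * (M\<^sup>2 * S)"
    by (rule combine[OF M]) (subst SS[symmetric], simp add: power2_eq_square)
  moreover have "\<forall>\<gamma> \<delta>. \<gamma> > 1 \<and> 1 / \<gamma> + 1 / \<delta> = 1 \<longrightarrow>
      N * P p * P q \<le> N * (M * C (\<gamma> * q) * S powr (1 / p) * D q \<delta>)"
    by (intro allI impI, rule combine[OF M(1) H(2)]) auto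
  moreover have "N * P p * P q \<le> N * (M * C q * S powr (1 / p) * X q)"
    by (rule combine[OF M(1) X(2)]) simp
  moreover have "\<forall>\<alpha> \<beta>. \<alpha> > 1 \<and> 1 / \<alpha> + 1 / \<beta> = 1 \<longrightarrow>
      N * P p * P q \<le> N * (M * C (\<alpha> * p) * S powr (1 / q) * D p \<beta>)"
    by (intro allI impI, rule combine[OF H(1) M(2)]) auto
  moreover have "\<forall>\<alpha> \<beta> \<gamma> \<delta>. \<alpha> > 1 \<and> 1 / \<alpha> + 1 / \<beta> = 1 \<and> \<gamma> > 1 \<and> 1 / \<gamma> + 1 / \<delta> = 1 \<longrightarrow>
      N * P p * P q \<le> N * (C (\<alpha> * p) * C (\<gamma> * q) * D p \<beta> * D q \<delta>)"
  proof (intro allI impI)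
    fix \<alpha> \<beta> \<gamma> \<delta> :: real
    assume "\<alpha> > 1 \<and> 1 / \<alpha> + 1 / \<beta> = 1 \<and> \<gamma> > 1 \<and> 1 / \<gamma> + 1 / \<delta> = 1"
    then show "N * P p * P q \<le> N * (C (\<alpha> * p) * C (\<gamma> * q) * D p \<beta> * D q \<delta>)"
      by (intro combine[OF H(1)[of \<alpha> \<beta>] H(2)[of \<gamma> \<delta>]]) auto
  qed
  moreover have "\<forall>\<alpha> \<beta>. \<alpha> > 1 \<and> 1 / \<alpha> + 1 / \<beta> = 1 \<longrightarrow>
      N * P p * P q \<le> N * (C q * C (\<alpha> * p) * X q * D p \<beta>)"
    by (intro allI impI, rule combine[OF H(1) X(2)]) auto
  moreover have "N * P p * P q \<le> N * (M * C p * X p * S powr (1 / q))"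
    by (rule combine[OF X(1) M(2)]) simp
  moreover have "\<forall>\<gamma> \<delta>. \<gamma> > 1 \<and> 1 / \<gamma> + 1 / \<delta> = 1 \<longrightarrow>
      N * P p * P q \<le> N * (C p * C (\<gamma> * q) * X p * D q \<delta>)"
    by (intro allI impI, rule combine[OF X(1) H(2)]) auto
  moreover have "N * P p * P q \<le> N * (C p * C q * (MAX i\<in>?A. Si i))"
    by (rule combine[OF X]) (subst XX[symmetric], simp)
  ultimately show ?thesis
    unfolding Let_def MM
    unfolding P_def C_def M_def X_def N_def D[of q] fun_cong[OF fun_cong[OF D_def], of p]
    by - (intro conjI)
qed

end
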